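(* Summing over partitions into even parts, $$\frac{\pi}{2}=\sum_{\lambda\in\mathcal P_{2\mathbb Z}}\frac{1}{n_\lambda^2}.$$
   Context: A partition is a finite non-increasing sequence $\lambda=(\lambda_1,\dots,\lambda_r)$ of positive integers, including the empty partition $\emptyset$ ($r=0$). $\mathcal P_{2\mathbb Z}$ is the set of partitions all of whose parts are even (including $\emptyset$). The integer of $\lambda$ is the product of its parts $n_\lambda:=\lambda_1\lambda_2\cdots\lambda_r$, with $n_\emptyset:=1$. *)

theory Defs
  imports "HOL-Analysis.Analysis"
begin

definition partitions :: "nat list set" where
  "partitions = {l. sorted_wrt (\<ge>) l \<and> (\<forall>x\<in>set l. 0 < x)}"

definition even_partitions :: "nat list set" where
  "even_partitions = {l \<in> partitions. \<forall>x\<in>set l. even x}"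

definition partition_integer :: "nat list \<Rightarrow> nat" where
  "partition_integer l = prod_list l"

end

theory Submission
  imports Defs
begin

text \<open>Expanding each factor of \<open>\<Prod>k\<in>A. 1 / (1 - f k)\<close> as a geometric series and multiplying
  out yields one term \<open>\<Prod>i. f (l\<^sub>i)\<close> for every partition \<open>l\<close> with parts in \<open>A\<close>. For
  \<open>f k = 1 / k\<^sup>2\<close> and \<open>A = {2, 4, \<dots>, 2 N}\<close> these products are the partial products of Wallis'
  product for \<open>\<pi> / 2\<close>; since all terms are nonnegative, one may let \<open>N\<close> tend to infinity.\<close>

definition descending_lists :: "'a::linorder set \<Rightarrow> 'a list set" where
  "descending_lists A = {l. sorted_wrt (\<ge>) l \<and> set l \<subseteq> A}"

lemma descending_lists_empty [simp]: "descending_lists {} = {[]}"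
  by (auto simp: descending_lists_def)

lemma descending_lists_mono: "A \<subseteq> B \<Longrightarrow> descending_lists A \<subseteq> descending_lists B"
  by (auto simp: descending_lists_def)

text \<open>As \<open>b\<close> exceeds every element of \<open>A\<close>, its copies must come
  first in a descending list; \<open>m\<close> is their number.\<close>

lemma descending_lists_insert_max_split:
  assumes "\<forall>a\<in>A. a < b" "l \<in> descending_lists (insert b A)"
  shows "\<exists>m. \<exists>l'\<in>descending_lists A. l = replicate m b @ l'"
  using assms(2)
proof (induction l)
  case Nil
  show ?case
    by (intro exI[of _ 0] bexI[of _ "[]"]) (auto simp: descending_lists_def)
next
  case (Cons x l)
  show ?case
  proof (cases "x = b")
    case True
    obtain m l' where "l' \<in> descending_lists A" "l = replicate m b @ l'"
      using Cons by (auto simp: descending_lists_def)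
    with True show ?thesis
      by (intro exI[of _ "Suc m"] bexI[of _ l']) auto
  next
    case False
    \<comment> \<open>The head lies in \<open>A\<close>, hence below \<open>b\<close>, and it bounds
      all later entries, so \<open>b\<close> does not occur at all.\<close>
    with Cons.prems assms(1) have "x # l \<in> descending_lists A"
      by (fastforce simp: descending_lists_def)
    then show ?thesis
      by (intro exI[of _ 0] bexI[of _ "x # l"]) auto
  qed
qed

lemma bij_betw_descending_lists_insert_max:
  assumes "\<forall>a\<in>A. a < b"
  shows "bij_betw (\<lambda>(m, l). replicate m b @ l) (UNIV \<times> descending_lists A)
           (descending_lists (insert b A))"
proof (rule bij_betw_imageI)
  \<comment> \<open>Injectivity: \<open>b\<close> does not occur in \<open>l\<close>, so the
    multiplicity of \<open>b\<close> recovers \<open>m\<close>, and then \<open>l\<close> is what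
    remains.\<close>
  have count: "count_list (replicate m b @ l) b = m" if "l \<in> descending_lists A" for m l
  proof -
    have "b \<notin> set l"
      using that assms by (auto simp: descending_lists_def)
    then show ?thesis
      by (induction m) (auto simp: count_list_0_iff)
  qed
  show "inj_on (\<lambda>(m, l). replicate m b @ l) (UNIV \<times> descending_lists A)"
  proof (rule inj_onI, clarify)
    fix m n l l'
    assume "l \<in> descending_lists A" "l' \<in> descending_lists A"
      and eq: "replicate m b @ l = replicate n b @ l'"
    then have "m = n"
      using count by metis
    with eq show "m = n \<and> l = l'"
      by simp
  qed
next
  have "replicate m b @ l \<in> descending_lists (insert b A)" if "l \<in> descending_lists A" for m l
    using that assms
    by (induction m) (auto simp: descending_lists_def less_imp_le)
  then show "(\<lambda>(m, l). replicate m b @ l) ` (UNIV \<times> descending_lists A)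
      = descending_lists (insert b A)"
    using descending_lists_insert_max_split[OF assms] by fastforce
qed

text \<open>Adjoining a new largest element \<open>b\<close> to \<open>A\<close> makes a list the
  same as a multiplicity \<open>m\<close> of \<open>b\<close> together with a list over
  \<open>A\<close>, so the sum factors into the geometric series of \<open>f b\<close> and the sum
  for \<open>A\<close>.\<close>

lemma has_sum_descending_lists:
  fixes f :: "'a::linorder \<Rightarrow> real"
  assumes "finite A" "\<And>a. a \<in> A \<Longrightarrow> 0 \<le> f a" "\<And>a. a \<in> A \<Longrightarrow> f a < 1"
  shows "((\<lambda>l. prod_list (map f l)) has_sum (\<Prod>a\<in>A. 1 / (1 - f a))) (descending_lists A)"
  using assms
proof (induction A rule: finite_linorder_max_induct)
  case empty
  show ?case
    by (simp add: has_sum_finiteI)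
next
  case (insert b A)
  define P where "P = (\<Prod>a\<in>A. 1 / (1 - f a))"
  have IH: "((\<lambda>l. prod_list (map f l)) has_sum P) (descending_lists A)"
    unfolding P_def using insert by auto
  have b: "0 \<le> f b" "f b < 1"
    using insert.prems by auto
  let ?h = "\<lambda>(m, l). f b ^ m * prod_list (map f l)"
  have inner: "((\<lambda>l. ?h (m, l)) has_sum f b ^ m * P) (descending_lists A)" for m
    using has_sum_cmult_right[OF IH] by simp
  have "((\<lambda>m. f b ^ m * P) has_sum (1 / (1 - f b) * P)) UNIV"
    using b
    by (intro has_sum_cmult_left sums_nonneg_imp_has_sum geometric_sums) auto
  moreover have "0 \<le> ?h (m, l)" if "l \<in> descending_lists A" for m l
    using that b insert.prems(1)
    by (fastforce simp: descending_lists_def intro!: mult_nonneg_nonneg prod_list_nonneg)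
  \<comment> \<open>Nonnegativity of the terms turns the iterated sum, first over \<open>l\<close>
    and then over \<open>m\<close>, into an unordered sum over all pairs.\<close>
  ultimately have "(?h has_sum (1 / (1 - f b) * P)) (UNIV \<times> descending_lists A)"
    using inner
    by (intro has_sum_SigmaI[where g = "\<lambda>m. f b ^ m * P"]
          summable_on_SigmaI[where g = "\<lambda>m. f b ^ m * P"]) (auto simp: has_sum_imp_summable)
  also have "?this \<longleftrightarrow> ((\<lambda>x. prod_list (map f (case x of (m, l) \<Rightarrow> replicate m b @ l)))
      has_sum (1 / (1 - f b) * P)) (UNIV \<times> descending_lists A)"
    by (intro has_sum_cong) (auto simp: map_replicate_const)
  also have "\<dots> \<longleftrightarrow> ((\<lambda>l. prod_list (map f l)) has_sum (1 / (1 - f b) * P))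
      (descending_lists (insert b A))"
    by (rule has_sum_reindex_bij_betw[OF bij_betw_descending_lists_insert_max[OF insert.hyps(2)]])
  finally show ?case
    using insert.hyps by (subst prod.insert) (auto simp: P_def)
qed

text \<open>A finite subset of the union already lies in a single \<open>A n\<close>, so its sum is
  at most \<open>S n\<close>, hence at most \<open>s\<close>. This gives summability and the upper
  bound; conversely the total dominates every \<open>S n\<close>, hence their limit.\<close>

lemma has_sum_incseq_UN:
  fixes f :: "'a \<Rightarrow> real"
  assumes "incseq A" "\<And>n. (f has_sum S n) (A n)" "S \<longlonglongrightarrow> s"
    and nonneg: "\<And>x. x \<in> (\<Union>n. A n) \<Longrightarrow> 0 \<le> f x"
  shows "(f has_sum s) (\<Union>n. A n)"
proof -
  have "incseq S"
    using assms(2) nonneg incseq_SucD[OF assms(1)]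
    by (intro incseq_SucI has_sum_mono2[OF assms(2) assms(2)]) blast+
  have bound: "sum f F \<le> s" if F: "F \<subseteq> (\<Union>n. A n)" "finite F" for F
  proof -
    have "\<exists>n. F \<subseteq> A n"
      using F(2,1)
    proof (induction F)
      case (insert x F)
      then obtain m n where "F \<subseteq> A m" "x \<in> A n"
        by auto
      moreover have "A m \<subseteq> A (max m n)" "A n \<subseteq> A (max m n)"
        using assms(1) by (simp_all add: incseq_def)
      ultimately show ?case
        by blast
    qed simp
    then obtain n where "F \<subseteq> A n" ..
    then have "sum f F \<le> S n"
      using nonneg by (intro finite_sum_le_has_sum[OF assms(2) F(2)]) auto
    also have "S n \<le> s"
      using \<open>incseq S\<close> assms(3) by (rule incseq_le)
    finally show ?thesis .
  qed
  have "f summable_on (\<Union>n. A n)"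
    using bound nonneg by (intro nonneg_bdd_above_summable_on bdd_aboveI2[where M = s]) auto
  then obtain t where t: "(f has_sum t) (\<Union>n. A n)"
    by (auto simp: summable_on_def)
  have "S n \<le> t" for n
    using assms(2) t by (rule has_sum_mono2) (use nonneg in auto)
  then have "s \<le> t"
    using assms(3) by (auto intro: LIMSEQ_le_const2)
  moreover have "t \<le> s"
    using t bound by (rule has_sum_le_finite_sums) auto
  ultimately show ?thesis
    using t by simp
qed

lemma even_partitions_eq_UN:
  "even_partitions = (\<Union>N. descending_lists ((*) 2 ` {1..N}))"
proof (intro equalityI subsetI)
  fix l assume l: "l \<in> even_partitions"
  \<comment> \<open>\<open>sum_list l\<close> serves as \<open>N\<close>: it bounds every entry
    \<open>x\<close>, hence also \<open>x div 2\<close>, and it is defined for the empty list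
    too.\<close>
  have "x \<in> (*) 2 ` {1..sum_list l}" if "x \<in> set l" for x
  proof -
    have "0 < x" "even x"
      using l that by (auto simp: even_partitions_def partitions_def)
    then have "x = 2 * (x div 2)" "x div 2 \<in> {1..sum_list l}"
      using member_le_sum_list[OF that] by auto
    then show ?thesis
      by blast
  qed
  with l show "l \<in> (\<Union>N. descending_lists ((*) 2 ` {1..N}))"
    by (auto simp: even_partitions_def partitions_def descending_lists_def)
qed (fastforce simp: even_partitions_def partitions_def descending_lists_def)

theorem corollary2p1:
  "((\<lambda>l. 1 / (real (partition_integer l))\<^sup>2) has_sum (pi / 2)) even_partitions"
proof -
  define f :: "nat \<Rightarrow> real" where "f k = 1 / (real k)\<^sup>2" for k
  have f_nonneg: "0 \<le> f k" for k
    by (simp add: f_def)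
  \<comment> \<open>The geometric series would diverge at \<open>f 1 = 1\<close>; the parts
    \<open>2 * k\<close> with \<open>k\<close> at least 1 avoid this.\<close>
  have f_less_1: "f k < 1" if "1 < k" for k
    using that one_less_power[of "real k" 2] by (simp add: f_def)
  have term_eq: "1 / (real (partition_integer l))\<^sup>2 = prod_list (map f l)" for l
    unfolding partition_integer_def
    by (induction l) (simp_all add: f_def power_mult_distrib flip: divide_divide_eq_left')
  \<comment> \<open>For \<open>a = 2 * k\<close> the factor 1 / (1 - 1 / (4 k^2)) equals 4 k^2 / (4
    k^2 - 1), the k-th factor of Wallis' product.\<close>
  have "(\<Prod>a\<in>(*) 2 ` {1..N}. 1 / (1 - f a)) = (\<Prod>k=1..N. (4 * real k^2) / (4 * real k^2 - 1))" for N
    by (subst prod.reindex)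
      (auto simp: inj_on_def f_def power_mult_distrib field_simps intro!: prod.cong)
  then have "(\<lambda>N. \<Prod>a\<in>(*) 2 ` {1..N}. 1 / (1 - f a)) \<longlonglongrightarrow> pi / 2"
    using wallis by simp
  moreover have "((\<lambda>l. prod_list (map f l)) has_sum (\<Prod>a\<in>(*) 2 ` {1..N}. 1 / (1 - f a)))
      (descending_lists ((*) 2 ` {1..N}))" for N
    by (intro has_sum_descending_lists) (auto intro: f_nonneg f_less_1)
  moreover have "incseq (\<lambda>N. descending_lists ((*) 2 ` {1..N::nat}))"
    by (intro incseq_SucI descending_lists_mono) auto
  moreover have "0 \<le> prod_list (map f l)" for l
    by (auto intro!: prod_list_nonneg f_nonneg)
  ultimately have "((\<lambda>l. prod_list (map f l)) has_sum (pi / 2)) even_partitions"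
    unfolding even_partitions_eq_UN by (intro has_sum_incseq_UN)
  then show ?thesis
    by (simp add: term_eq)
qed

end
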